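(* Let $\Phi\subset N_{\mathbb R}$ be an admissible domain. If $\Phi$ is compact, then for every $t>0$ the tropical propagation $\Phi(t)$ is a finite polygon, i.e. a bounded set that is the intersection of finitely many half-planes with rational slope.
   Context: $N\cong\mathbb Z^2$ is a rank two lattice, $N_{\mathbb R}=N\otimes\mathbb R\cong\mathbb R^2$, $M=\operatorname{Hom}(N,\mathbb Z)$. A half-plane with rational slope is a set $H=\{p\in N_{\mathbb R}:\lambda(p)\ge c\}$ with $c\in\mathbb R$ and $\lambda\in M$ a primitive (nonzero, non-divisible) element, called the slope of $H$. For $t\in\mathbb R$ put $H(t)=\{p:\lambda(p)\ge c+t\}$. For a convex $\Phi\subset N_{\mathbb R}$, $\mathcal H_\Phi$ is the set of support half-planes of $\Phi$ with rational slope, i.e. rational-slope half-planes $H$ with $H\supset\Phi$ and $\partial H\cap\partial\Phi\ne\emptyset$. $\Phi$ is admissible if it is closed, convex and $\mathcal H_\Phi\neq\emptyset$. For admissible $\Phi$ and $t\ge0$, the tropical propagation of $\Phi$ in time $t$ is $\Phi(t)=\bigcap_{H\in\mathcal H_\Phi}H(t)$. A finite polygon may be degenerate (a point or an interval) or empty. *)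

theory Defs
  imports "HOL-Analysis.Analysis"
begin

text \<open>
  The real vector space \<open>N\<^sub>\<real>\<close> is a Euclidean space of dimension two, in which \<open>N\<close> is the
  subgroup generated by a basis; \<open>M = Hom(N,\<int>)\<close> is identified with the linear functionals
  on \<open>N\<^sub>\<real>\<close> that are integral on \<open>N\<close>.  Only the vector space structure and the topology of the
  Euclidean space are used, never its inner product.
\<close>

definition rank_two_lattice :: "'a::euclidean_space set \<Rightarrow> bool" where
  "rank_two_lattice N \<longleftrightarrow>
     (\<exists>e f. e \<noteq> f \<and> independent {e, f} \<and>
        N = {of_int m *\<^sub>R e + of_int n *\<^sub>R f | m n :: int. True})"

definition dual_lattice :: "'a::euclidean_space set \<Rightarrow> ('a \<Rightarrow> real) set" where
  "dual_lattice N = {l. linear l \<and> l ` N \<subseteq> \<int>}"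

definition primitive :: "'a::euclidean_space set \<Rightarrow> ('a \<Rightarrow> real) \<Rightarrow> bool" where
  "primitive N l \<longleftrightarrow>
     l \<in> dual_lattice N \<and> l \<noteq> (\<lambda>_. 0) \<and>
     (\<forall>k::int. \<forall>m \<in> dual_lattice N. l = (\<lambda>p. of_int k * m p) \<longrightarrow> \<bar>k\<bar> = 1)"

definition half_plane :: "('a::euclidean_space \<Rightarrow> real) \<Rightarrow> real \<Rightarrow> 'a set" where
  "half_plane l c = {p. l p \<ge> c}"

definition rational_half_plane :: "'a::euclidean_space set \<Rightarrow> 'a set \<Rightarrow> bool" where
  "rational_half_plane N H \<longleftrightarrow> (\<exists>l c. primitive N l \<and> H = half_plane l c)"

text \<open>
  The shift \<open>H(t)\<close> is a function of the set \<open>H\<close>: in a rank two lattice the primitive slope and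
  the constant are determined by \<open>H\<close>, see \<open>half_plane_shift_half_plane\<close> below.
\<close>

definition half_plane_shift :: "'a::euclidean_space set \<Rightarrow> 'a set \<Rightarrow> real \<Rightarrow> 'a set" where
  "half_plane_shift N H t =
     (THE H'. \<exists>l c. primitive N l \<and> H = half_plane l c \<and> H' = half_plane l (c + t))"

definition support_half_planes :: "'a::euclidean_space set \<Rightarrow> 'a set \<Rightarrow> 'a set set" where
  "support_half_planes N \<Phi> =
     {H. rational_half_plane N H \<and> \<Phi> \<subseteq> H \<and> frontier H \<inter> frontier \<Phi> \<noteq> {}}"

definition admissible :: "'a::euclidean_space set \<Rightarrow> 'a set \<Rightarrow> bool" where
  "admissible N \<Phi> \<longleftrightarrow> closed \<Phi> \<and> convex \<Phi> \<and> support_half_planes N \<Phi> \<noteq> {}"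

definition tropical_propagation :: "'a::euclidean_space set \<Rightarrow> 'a set \<Rightarrow> real \<Rightarrow> 'a set" where
  "tropical_propagation N \<Phi> t = (\<Inter>H \<in> support_half_planes N \<Phi>. half_plane_shift N H t)"

definition finite_polygon :: "'a::euclidean_space set \<Rightarrow> 'a set \<Rightarrow> bool" where
  "finite_polygon N P \<longleftrightarrow>
     bounded P \<and> (\<exists>\<H>. finite \<H> \<and> (\<forall>H \<in> \<H>. rational_half_plane N H) \<and> P = \<Inter>\<H>)"

lemma half_plane_eq_proportional:
  fixes l m :: "'a::euclidean_space \<Rightarrow> real"
  assumes l: "linear l" "l \<noteq> (\<lambda>_. 0)" and m: "linear m" "m \<noteq> (\<lambda>_. 0)"
    and eq: "half_plane l c = half_plane m d"
  obtains k where "k > 0" "l = (\<lambda>p. k * m p)" "c = k * d"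
proof -
  have iff: "l p \<ge> c \<longleftrightarrow> m p \<ge> d" for p
    using eq unfolding half_plane_def by blast
  obtain u where u: "m u \<noteq> 0" using m(2) by auto
  define w where "w = (1 / m u) *\<^sub>R u"
  have w: "m w = 1" using u by (simp add: w_def linear_scale[OF m(1)])
  have ladd: "l (p + s *\<^sub>R v) = l p + s * l v" for p s v
    by (simp add: linear_add[OF l(1)] linear_scale[OF l(1)])
  have madd: "m (p + s *\<^sub>R v) = m p + s * m v" for p s v
    by (simp add: linear_add[OF m(1)] linear_scale[OF m(1)])
  have ker: "l v = 0" if v: "m v = 0" for v
  proof (rule ccontr)
    assume lv: "l v \<noteq> 0"
    define p where "p = d *\<^sub>R w + ((c - 1 - l (d *\<^sub>R w)) / l v) *\<^sub>R v"
    have "m p = d" unfolding p_def madd v by (simp add: linear_scale[OF m(1)] w)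
    moreover have "l p = c - 1" unfolding p_def ladd using lv by simp
    ultimately show False using iff[of p] by simp
  qed
  define k where "k = l w"
  have lk: "l v = k * m v" for v
  proof -
    have "l (v + (- m v) *\<^sub>R w) = 0" by (rule ker, unfold madd, simp add: w)
    then show ?thesis unfolding ladd k_def by simp
  qed
  have "k \<noteq> 0" using l(2) lk by auto
  moreover have mw: "m (s *\<^sub>R w) = s" for s by (simp add: linear_scale[OF m(1)] w)
  have iffk: "k * s \<ge> c \<longleftrightarrow> s \<ge> d" for s using iff[of "s *\<^sub>R w"] lk mw by simp
  have kpos: "k > 0"
  proof (rule ccontr)
    assume "\<not> k > 0"
    with \<open>k \<noteq> 0\<close> have k: "k < 0" by simp
    define s where "s = max d ((c - 1) / k)"
    have "k * s \<le> k * ((c - 1) / k)" using k by (intro mult_left_mono_neg) (auto simp: s_def)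
    then have "k * s \<le> c - 1" using k by simp
    moreover have "s \<ge> d" by (simp add: s_def)
    ultimately show False using iffk[of s] by simp
  qed
  have "c \<le> k * d" using iffk[of d] by simp
  moreover have "d \<le> c / k" using iffk[of "c / k"] kpos by simp
  then have "k * d \<le> c" using kpos by (simp add: field_simps)
  ultimately show thesis using that[OF kpos] lk by auto
qed

lemma dual_lattice_combine:
  assumes "l \<in> dual_lattice N" "m \<in> dual_lattice N"
  shows "(\<lambda>p. of_int x * l p + of_int y * m p) \<in> dual_lattice N"
proof -
  have "linear (\<lambda>p. real_of_int x * l p + real_of_int y * m p)"
    using assms unfolding dual_lattice_def
    by (auto intro!: linearI simp: linear_add linear_scale algebra_simps)
  moreover have "real_of_int x * l p + real_of_int y * m p \<in> \<int>" if "p \<in> N" for p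
    using assms that unfolding dual_lattice_def by (auto intro!: Ints_add Ints_mult)
  ultimately show ?thesis unfolding dual_lattice_def by auto
qed

lemma primitive_proportional_eq:
  fixes N :: "'a::euclidean_space set"
  assumes dim: "DIM('a) = 2" and N: "rank_two_lattice N"
    and l: "primitive N l" and m: "primitive N m"
    and k: "k > 0" "l = (\<lambda>p. k * m p)"
  shows "k = 1"
proof -
  have lM: "l \<in> dual_lattice N" and mM: "m \<in> dual_lattice N"
    using l m by (auto simp: primitive_def)
  have lm: "linear m" using mM by (simp add: dual_lattice_def)
  obtain e f where ef: "e \<noteq> f" "independent {e, f}"
    and Neq: "N = {of_int a *\<^sub>R e + of_int b *\<^sub>R f | a b :: int. True}"
    using N unfolding rank_two_lattice_def by blast
  have "e = of_int 1 *\<^sub>R e + of_int 0 *\<^sub>R f" by simp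
  then have eN: "e \<in> N" unfolding Neq by blast
  have "f = of_int 0 *\<^sub>R e + of_int 1 *\<^sub>R f" by simp
  then have fN: "f \<in> N" unfolding Neq by blast
  have span: "span {e, f} = UNIV"
    using independent_explicit card_ge_dim_independent[of "{e,f}" UNIV] ef dim by auto
  have "\<exists>n\<in>{e, f}. m n \<noteq> 0"
  proof (rule ccontr)
    assume "\<not> ?thesis"
    then have "m x = 0" if "x \<in> span {e, f}" for x
      using linear_eq_0_on_span[OF lm, of "{e,f}" x] that by blast
    then show False using m span by (auto simp: primitive_def)
  qed
  then obtain n where n: "n \<in> N" "m n \<noteq> 0" using eN fN by blast
  have "l n \<in> \<int>" "m n \<in> \<int>" using lM mM n(1) by (auto simp: dual_lattice_def)
  then have "l n / m n \<in> \<rat>" by (meson Ints_subset_Rats Rats_divide subsetD)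
  then have "k \<in> \<rat>" using k n by simp
  then obtain a b :: int where ab: "b > 0" "coprime a b" "k = of_int a / of_int b"
    by (metis Rats_cases')
  obtain x y where xy: "x * a + y * b = 1"
    using ab(2) bezout_int[of a b] by auto
  have xyr: "real_of_int x * of_int a + real_of_int y * of_int b = 1"
    using arg_cong[OF xy, of real_of_int] by simp
  define \<nu> where "\<nu> = (\<lambda>p. of_int x * l p + of_int y * m p)"
  have \<nu>: "\<nu> \<in> dual_lattice N" unfolding \<nu>_def by (rule dual_lattice_combine[OF lM mM])
  have bl: "of_int b * l p = of_int a * m p" for p using ab k by simp
  have "of_int a * \<nu> p = l p" for p
  proof -
    have "of_int a * \<nu> p = of_int x * of_int a * l p + of_int y * (of_int a * m p)"
      by (simp add: \<nu>_def algebra_simps)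
    also have "\<dots> = (of_int x * of_int a + of_int y * of_int b) * l p"
      unfolding bl[symmetric] by (simp add: algebra_simps)
    finally show ?thesis by (simp add: xyr)
  qed
  then have "\<bar>a\<bar> = 1" using l \<nu> unfolding primitive_def by (metis (no_types, lifting) ext)
  moreover have "of_int b * \<nu> p = m p" for p
  proof -
    have "of_int b * \<nu> p = of_int x * (of_int b * l p) + of_int y * of_int b * m p"
      by (simp add: \<nu>_def algebra_simps)
    also have "\<dots> = (of_int x * of_int a + of_int y * of_int b) * m p"
      unfolding bl by (simp add: algebra_simps)
    finally show ?thesis by (simp add: xyr)
  qed
  then have "\<bar>b\<bar> = 1" using m \<nu> unfolding primitive_def by (metis (no_types, lifting) ext)
  ultimately show "k = 1" using ab k(1) by (auto simp: abs_if split: if_splits)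
qed

lemma half_plane_inject:
  fixes N :: "'a::euclidean_space set"
  assumes "DIM('a) = 2" "rank_two_lattice N" "primitive N l" "primitive N m"
    and eq: "half_plane l c = half_plane m d"
  shows "l = m \<and> c = d"
proof -
  have "linear l" "l \<noteq> (\<lambda>_. 0)" "linear m" "m \<noteq> (\<lambda>_. 0)"
    using assms by (auto simp: primitive_def dual_lattice_def)
  then obtain k where k: "k > 0" "l = (\<lambda>p. k * m p)" "c = k * d"
    using half_plane_eq_proportional eq by blast
  have "k = 1" by (rule primitive_proportional_eq[OF assms(1-4) k(1,2)])
  with k show ?thesis by simp
qed

lemma half_plane_shift_half_plane:
  fixes N :: "'a::euclidean_space set"
  assumes "DIM('a) = 2" "rank_two_lattice N" "primitive N l"
  shows "half_plane_shift N (half_plane l c) t = half_plane l (c + t)"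
  unfolding half_plane_shift_def
  using assms half_plane_inject[OF assms(1,2)] by (intro the_equality) blast+

end

theory Submission
  imports Defs
begin

text \<open>
  Write \<open>m l\<close> for the minimum of a functional \<open>l\<close> on \<open>\<Phi>\<close>, so that \<open>\<Phi>(t)\<close> is cut out by the
  inequalities \<open>l \<ge> m l + t\<close> over all primitive \<open>l\<close>.  A point \<open>p\<close> outside the interior of \<open>\<Phi>\<close>
  admits a nonzero real functional that is minimal at \<open>p\<close> on \<open>\<Phi> \<union> {p}\<close>; simultaneous Diophantine
  approximation of a ray by lattice points gives a dual lattice vector \<open>l\<close> so near a positive
  multiple of that functional that \<open>l p < m l + t\<close>.  Hence \<open>\<Phi>(t)\<close> lies in the interior of \<open>\<Phi>\<close>,
  and by compactness so does the intersection \<open>K\<close> of finitely many of the shifted half-planes,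
  which can be chosen compact.  As \<open>K\<close> has positive distance from the complement of \<open>\<Phi>\<close>, the
  difference \<open>l p - m l\<close> is at least \<open>t\<close> for all \<open>p \<in> K\<close> once the coordinates of \<open>l\<close> are large, so
  only finitely many further half-planes matter.
\<close>

section \<open>Convex sets and half-planes\<close>

text \<open>If the interior is empty, \<open>S\<close> lies in a hyperplane whose normal works up to
  sign. Otherwise \<open>p\<close> is separated from the convex interior, and the inequality passes
  to the closure, which contains \<open>S\<close>.\<close>

lemma exists_supporting_functional:
  fixes S :: "'a::euclidean_space set"
  assumes S: "convex S" and p: "p \<notin> interior S"
  obtains a where "a \<noteq> 0" "\<And>x. x \<in> S \<Longrightarrow> a \<bullet> p \<le> a \<bullet> x"
proof (cases "interior S = {}")
  case True
  then obtain a b where a: "a \<noteq> 0" "S \<subseteq> {x. a \<bullet> x = b}"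
    using empty_interior_subset_hyperplane[OF S] by blast
  show thesis
  proof (cases "a \<bullet> p \<le> b")
    case True
    with a show thesis by (intro that[of a]) auto
  next
    case False
    with a show thesis by (intro that[of "-a"]) auto
  qed
next
  case False
  let ?T = "(\<lambda>x. x - p) ` interior S"
  have "convex ?T" using S by (simp add: convex_interior convex_translation_subtract_eq)
  moreover have "0 \<notin> ?T" using p by auto
  ultimately obtain a where a: "a \<noteq> 0" "\<forall>y\<in>?T. 0 \<le> a \<bullet> y"
    using separating_hyperplane_set_0 by blast
  then have "interior S \<subseteq> {x. a \<bullet> p \<le> a \<bullet> x}" by (auto simp: inner_diff_right)
  then have "closure (interior S) \<subseteq> {x. a \<bullet> p \<le> a \<bullet> x}"
    by (intro closure_minimal closed_halfspace_ge)
  then have "S \<subseteq> {x. a \<bullet> p \<le> a \<bullet> x}"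
    using convex_closure_interior[OF S False] closure_subset by blast
  with a(1) show thesis by (intro that[of a]) auto
qed

lemma interior_half_plane:
  fixes l :: "'a::euclidean_space \<Rightarrow> real"
  assumes "linear l" "l \<noteq> (\<lambda>_. 0)"
  shows "interior (half_plane l c) = {p. l p > c}"
proof -
  define a where "a = adjoint l 1"
  have l: "l = (\<lambda>p. a \<bullet> p)"
    using adjoint_works[OF assms(1), of _ 1] by (simp add: a_def inner_commute fun_eq_iff)
  with assms(2) have "a \<noteq> 0" by auto
  then show ?thesis
    unfolding half_plane_def l by (simp add: interior_halfspace_ge)
qed

lemma closed_half_plane:
  fixes l :: "'a::euclidean_space \<Rightarrow> real"
  assumes "linear l"
  shows "closed (half_plane l c)"
proof -
  have "continuous_on UNIV l"
    using assms by (simp add: linear_continuous_on linear_conv_bounded_linear)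
  then show ?thesis
    unfolding half_plane_def by (intro closed_Collect_le continuous_on_const)
qed

lemma linear_attains_Inf_on_compact:
  fixes l :: "'a::euclidean_space \<Rightarrow> real"
  assumes "linear l" "compact S" "S \<noteq> {}"
  obtains q where "q \<in> S" "l q = Inf (l ` S)" "\<And>x. x \<in> S \<Longrightarrow> Inf (l ` S) \<le> l x"
proof -
  have "continuous_on S l"
    using assms(1) by (simp add: linear_continuous_on linear_conv_bounded_linear)
  then obtain q where q: "q \<in> S" "\<And>x. x \<in> S \<Longrightarrow> l q \<le> l x"
    using continuous_attains_inf[OF assms(2,3)] by blast
  then have "Inf (l ` S) = l q" by (intro cInf_eq_minimum) auto
  with q that show thesis by simp
qed

section \<open>Support half-planes of a compact domain\<close>

lemma primitiveD:
  assumes "primitive N l"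
  shows "linear l" "l \<noteq> (\<lambda>_. 0)"
  using assms by (auto simp: primitive_def dual_lattice_def)

text \<open>A common frontier point lies in the closed set \<Phi>, so the constant of a support
  half-plane is a minimum. Conversely, compactness makes every primitive slope attain its minimum,
  so each slope occurs. The family can then be indexed by functionals instead of sets.\<close>

lemma support_half_planes_compact:
  fixes \<Phi> :: "'a::euclidean_space set"
  assumes \<Phi>: "compact \<Phi>" "\<Phi> \<noteq> {}"
  shows "support_half_planes N \<Phi> = {half_plane l (Inf (l ` \<Phi>)) | l. primitive N l}"
proof (intro equalityI subsetI)
  fix H assume "H \<in> support_half_planes N \<Phi>"
  then obtain l c q where l: "primitive N l" and H: "H = half_plane l c" and sub: "\<Phi> \<subseteq> H"
    and q: "q \<in> frontier H" "q \<in> frontier \<Phi>"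
    unfolding support_half_planes_def rational_half_plane_def by blast
  note lin = primitiveD[OF l]
  have "q \<in> \<Phi>" using q(2) \<Phi>(1) frontier_subset_closed compact_imp_closed by blast
  moreover have "l q = c"
    using q(1) closed_half_plane[OF lin(1)] unfolding H frontier_def interior_half_plane[OF lin]
    by (auto simp: half_plane_def)
  moreover have "c \<le> l x" if "x \<in> \<Phi>" for x
    using sub that unfolding H half_plane_def by blast
  ultimately have "Inf (l ` \<Phi>) = c" by (intro cInf_eq_minimum) auto
  with l H show "H \<in> {half_plane l (Inf (l ` \<Phi>)) | l. primitive N l}" by blast
next
  fix H assume "H \<in> {half_plane l (Inf (l ` \<Phi>)) | l. primitive N l}"
  then obtain l where l: "primitive N l" and H: "H = half_plane l (Inf (l ` \<Phi>))" by blast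
  note lin = primitiveD[OF l]
  obtain q where q: "q \<in> \<Phi>" "l q = Inf (l ` \<Phi>)" "\<And>x. x \<in> \<Phi> \<Longrightarrow> Inf (l ` \<Phi>) \<le> l x"
    using linear_attains_Inf_on_compact[OF lin(1) \<Phi>] by blast
  have sub: "\<Phi> \<subseteq> H" using q(3) by (auto simp: H half_plane_def)
  \<comment> \<open>As \<Phi> lies in \<open>H\<close>, its interior lies in that of
    \<open>H\<close>; hence the minimiser \<open>q\<close> is on both frontiers.\<close>
  have "q \<notin> interior H" unfolding H interior_half_plane[OF lin] using q(2) by simp
  then have "q \<in> frontier H \<inter> frontier \<Phi>"
    using q(1) sub interior_mono[OF sub] closure_subset by (auto simp: frontier_def)
  then show "H \<in> support_half_planes N \<Phi>"
    using l H sub unfolding support_half_planes_def rational_half_plane_def by blast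
qed

lemma tropical_propagation_compact:
  fixes N \<Phi> :: "'a::euclidean_space set"
  assumes "DIM('a) = 2" "rank_two_lattice N" "compact \<Phi>" "\<Phi> \<noteq> {}"
  shows "tropical_propagation N \<Phi> t
    = (\<Inter>l \<in> Collect (primitive N). half_plane l (Inf (l ` \<Phi>) + t))"
proof -
  have "half_plane_shift N (half_plane l (Inf (l ` \<Phi>))) t = half_plane l (Inf (l ` \<Phi>) + t)"
    if "primitive N l" for l
    by (rule half_plane_shift_half_plane[OF assms(1,2) that])
  moreover have "support_half_planes N \<Phi> = (\<lambda>l. half_plane l (Inf (l ` \<Phi>))) ` Collect (primitive N)"
    unfolding support_half_planes_compact[OF assms(3,4)] by blast
  ultimately show ?thesis unfolding tropical_propagation_def by simp
qed

section \<open>The dual lattice in coordinates\<close>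

text \<open>\<open>E\<close> and \<open>F\<close> are the basis dual to \<open>e\<close>,
  \<open>f\<close>. Dimension two is encoded in \<open>decompose\<close>, which says that
  \<open>e\<close> and \<open>f\<close> span the space.\<close>

locale lattice_basis =
  fixes N :: "'a::euclidean_space set" and e f :: 'a and E F :: "'a \<Rightarrow> real"
  assumes N_eq: "N = {of_int m *\<^sub>R e + of_int n *\<^sub>R f | m n :: int. True}"
    and linear_E: "linear E" and linear_F: "linear F"
    and dual_basis: "E e = 1" "E f = 0" "F e = 0" "F f = 1"
    and decompose: "v = E v *\<^sub>R e + F v *\<^sub>R f"
begin

definition functional :: "int \<Rightarrow> int \<Rightarrow> 'a \<Rightarrow> real" where
  "functional x y = (\<lambda>v. of_int x * E v + of_int y * F v)"

lemma linear_eq: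
  assumes "linear l"
  shows "l v = l e * E v + l f * F v"
  using arg_cong[OF decompose[of v], of l]
  by (simp add: linear_add[OF assms] linear_scale[OF assms])

lemma functional_basis: "functional x y e = of_int x" "functional x y f = of_int y"
  by (simp_all add: functional_def dual_basis)

lemma dual_lattice_eq_functionals: "dual_lattice N = {functional x y | x y. True}"
proof (intro equalityI subsetI)
  fix l assume l: "l \<in> dual_lattice N"
  then have lin: "linear l" and int: "\<And>v. v \<in> N \<Longrightarrow> l v \<in> \<int>" by (auto simp: dual_lattice_def)
  have "e = of_int 1 *\<^sub>R e + of_int 0 *\<^sub>R f" "f = of_int 0 *\<^sub>R e + of_int 1 *\<^sub>R f" by simp_all
  then have "e \<in> N" "f \<in> N" unfolding N_eq by blast+
  then obtain x y where "l e = of_int x" "l f = of_int y" using int by (metis Ints_cases)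
  then have "l v = functional x y v" for v
    unfolding functional_def using linear_eq[OF lin, of v] by simp
  then have "l = functional x y" by (rule ext)
  then show "l \<in> {functional x y | x y. True}" by blast
next
  fix l assume "l \<in> {functional x y | x y. True}"
  then obtain x y where l: "l = functional x y" by blast
  have lin: "linear l"
    unfolding l functional_def
    by (auto intro!: linearI simp: linear_add linear_scale linear_E linear_F algebra_simps)
  moreover have "l e \<in> \<int>" "l f \<in> \<int>" unfolding l functional_basis by simp_all
  then have "l v \<in> \<int>" if "v \<in> N" for v
    using that unfolding N_eq by (auto simp: linear_add[OF lin] linear_scale[OF lin])
  ultimately show "l \<in> dual_lattice N" by (auto simp: dual_lattice_def)
qed

lemma functional_neq_zero: "functional x y \<noteq> (\<lambda>_. 0) \<longleftrightarrow> x \<noteq> 0 \<or> y \<noteq> 0"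
proof -
  have "functional x y = (\<lambda>_. 0) \<longleftrightarrow> x = 0 \<and> y = 0"
  proof
    assume "functional x y = (\<lambda>_. 0)"
    then show "x = 0 \<and> y = 0" using functional_basis[of x y] by simp
  qed (simp add: functional_def)
  then show ?thesis by blast
qed

text \<open>Evaluation at \<open>e\<close> and \<open>f\<close> shows that an integer factor of the
  functional divides both coordinates.\<close>

lemma primitive_functional:
  assumes "coprime x y"
  shows "primitive N (functional x y)"
  unfolding primitive_def
proof (intro conjI allI ballI impI)
  show "functional x y \<in> dual_lattice N" by (auto simp: dual_lattice_eq_functionals)
  show "functional x y \<noteq> (\<lambda>_. 0)" unfolding functional_neq_zero using assms by auto
  fix k m assume "m \<in> dual_lattice N" and eq: "functional x y = (\<lambda>p. of_int k * m p)"
  then obtain x' y' where m: "m = functional x' y'" by (auto simp: dual_lattice_eq_functionals)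
  have "real_of_int x = of_int (k * x')" "real_of_int y = of_int (k * y')"
    using fun_cong[OF eq, of e] fun_cong[OF eq, of f] by (simp_all add: m functional_basis)
  then have "k dvd x" "k dvd y" unfolding of_int_eq_iff by simp_all
  then have "is_unit k" using assms coprime_common_divisor by blast
  then show "\<bar>k\<bar> = 1" by simp
qed

text \<open>Approximation yields dual lattice vectors that may be divisible; dividing the
  coordinates by their gcd repairs this.\<close>

lemma functional_multiple_of_primitive:
  assumes "x \<noteq> 0 \<or> y \<noteq> 0"
  obtains k m where "k \<ge> 1" "primitive N m" "functional x y = (\<lambda>p. of_int k * m p)"
proof -
  define k where "k = gcd x y"
  have k: "k > 0" using assms by (simp add: k_def)
  obtain x' y' where xy: "x = x' * k" "y = y' * k" "coprime x' y'"
    using gcd_coprime_exists[of x y] assms unfolding k_def by auto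
  have "functional x y = (\<lambda>p. of_int k * functional x' y' p)"
    by (simp add: xy functional_def fun_eq_iff algebra_simps)
  with k primitive_functional[OF xy(3)] show thesis by (intro that) auto
qed

section \<open>Diophantine approximation and points outside the interior\<close>

text \<open>Dirichlet's simultaneous theorem brings a multiple of the coordinate vector of
  \<open>a\<close> close to an integer vector. The error is absolute and does not grow with the
  scale \<open>s\<close>, so it can be compared with the fixed time \<open>t\<close>.\<close>

lemma real_functional_approximation:
  fixes \<epsilon> :: real
  assumes a: "a \<noteq> 0" and eps: "\<epsilon> > 0"
  obtains x y s where "x \<noteq> 0 \<or> y \<noteq> 0" "s > 0"
    "\<And>v. \<bar>functional x y v - s * (a \<bullet> v)\<bar> \<le> \<epsilon> * (\<bar>E v\<bar> + \<bar>F v\<bar>)"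
proof -
  \<comment> \<open>Dividing by this maximum gives one of the two coordinates \<theta> absolute
    value 1. The scale finally returned is \<open>of_int q / s\<close>.\<close>
  define s where "s = max \<bar>a \<bullet> e\<bar> \<bar>a \<bullet> f\<bar>"
  have lin: "linear (\<lambda>v. a \<bullet> v)" by (simp add: bounded_linear.linear bounded_linear_inner_right)
  have s: "s > 0"
  proof (rule ccontr)
    assume "\<not> s > 0"
    then have "a \<bullet> e = 0" "a \<bullet> f = 0" by (auto simp: s_def)
    then have "a \<bullet> a = 0" using linear_eq[OF lin, of a] by simp
    with a show False by simp
  qed
  define \<theta> where "\<theta> i = (if i = 0 then a \<bullet> e else a \<bullet> f) / s" for i :: nat
  obtain n :: nat where n: "n > 0" "1 / n < \<epsilon>"
    using eps nat_approx_posE[of \<epsilon>] by (metis of_nat_Suc zero_less_Suc)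
  obtain q p where q: "0 < q" and p: "\<And>i. i < 2 \<Longrightarrow> \<bar>of_int q * \<theta> i - of_int (p i)\<bar> < 1 / n"
    using Dirichlet_approx_simult[OF n(1), of 2 \<theta>] by blast
  \<comment> \<open>If both integers vanished, the coordinate of absolute value 1 would force
    \<open>q\<close> below \<open>1 / n\<close>, hence below 1.\<close>
  have nz: "p 0 \<noteq> 0 \<or> p 1 \<noteq> 0"
  proof (rule ccontr)
    assume "\<not> ?thesis"
    moreover obtain i where i: "i < 2" "\<bar>\<theta> i\<bar> = 1"
    proof -
      have "\<bar>\<theta> 0\<bar> = 1 \<or> \<bar>\<theta> 1\<bar> = 1"
        using s by (auto simp: \<theta>_def s_def max_def split: if_splits)
      then show thesis using that[of 0] that[of 1] by auto
    qed
    ultimately have "p i = 0" by (auto simp: less_2_cases_iff)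
    then have "of_int q < 1 / real n" using p[OF i(1)] i(2) q by (simp add: abs_mult)
    also have "\<dots> \<le> 1" using n by simp
    finally show False using q by simp
  qed
  have "\<bar>functional (p 0) (p 1) v - (of_int q / s) * (a \<bullet> v)\<bar> \<le> \<epsilon> * (\<bar>E v\<bar> + \<bar>F v\<bar>)" for v
  proof -
    have "functional (p 0) (p 1) v - (of_int q / s) * (a \<bullet> v)
        = - ((of_int q * \<theta> 0 - of_int (p 0)) * E v + (of_int q * \<theta> 1 - of_int (p 1)) * F v)"
      unfolding linear_eq[OF lin, of v] using s
      by (simp add: functional_def \<theta>_def field_simps)
    also have "\<bar>\<dots>\<bar> \<le> \<bar>of_int q * \<theta> 0 - of_int (p 0)\<bar> * \<bar>E v\<bar> + \<bar>of_int q * \<theta> 1 - of_int (p 1)\<bar> * \<bar>F v\<bar>"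
      unfolding abs_minus_cancel abs_mult[symmetric] by (rule abs_triangle_ineq)
    also have "\<dots> \<le> \<epsilon> * \<bar>E v\<bar> + \<epsilon> * \<bar>F v\<bar>"
      using p[of 0] p[of 1] n(2) by (intro add_mono mult_right_mono) auto
    finally show ?thesis by (simp add: algebra_simps)
  qed
  with nz q s show thesis by (intro that[of "p 0" "p 1" "of_int q / s"]) auto
qed

text \<open>The supporting functional is nonpositive on \<open>p - q\<close> for every
  \<open>q\<close> in \<Phi>, so an approximating lattice functional exceeds zero there by at most
  its error, which is made smaller than \<open>t\<close>.\<close>

lemma primitive_violated_outside_interior:
  assumes \<Phi>: "compact \<Phi>" "convex \<Phi>" "\<Phi> \<noteq> {}" and t: "t > 0" and p: "p \<notin> interior \<Phi>"
  obtains l where "primitive N l" "l p < Inf (l ` \<Phi>) + t"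
proof -
  obtain a where a: "a \<noteq> 0" "\<And>x. x \<in> \<Phi> \<Longrightarrow> a \<bullet> p \<le> a \<bullet> x"
    using exists_supporting_functional[OF \<Phi>(2) p] by blast
  have "continuous_on \<Phi> (\<lambda>x. \<bar>E (p - x)\<bar> + \<bar>F (p - x)\<bar>)"
    using linear_E linear_F
    by (intro continuous_intros linear_continuous_on_compose[where f = "\<lambda>x. p - x"])
  then obtain B where B: "\<And>x. x \<in> \<Phi> \<Longrightarrow> \<bar>E (p - x)\<bar> + \<bar>F (p - x)\<bar> \<le> B"
    by (rule continuous_attains_sup[OF \<Phi>(1,3), THEN bexE]) auto
  \<comment> \<open>The minimiser \<open>q\<close> is known only after the functional, hence after
    \<epsilon>; the bound \<open>B\<close>, uniform over \<Phi>, avoids circularity. The factor 2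
    yields a strict inequality.\<close>
  define \<epsilon> where "\<epsilon> = t / (2 * (\<bar>B\<bar> + 1))"
  have eps: "\<epsilon> > 0" using t by (auto simp: \<epsilon>_def)
  obtain x y s where xy: "x \<noteq> 0 \<or> y \<noteq> 0" and s: "s > 0"
    and app: "\<And>v. \<bar>functional x y v - s * (a \<bullet> v)\<bar> \<le> \<epsilon> * (\<bar>E v\<bar> + \<bar>F v\<bar>)"
    using real_functional_approximation[OF a(1) eps] by blast
  obtain k m where k: "k \<ge> 1" and m: "primitive N m" and km: "functional x y = (\<lambda>p. of_int k * m p)"
    using functional_multiple_of_primitive[OF xy] by blast
  note lin = primitiveD(1)[OF m]
  obtain q where q: "q \<in> \<Phi>" "m q = Inf (m ` \<Phi>)"
    using linear_attains_Inf_on_compact[OF lin \<Phi>(1,3)] by blast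
  have "functional x y (p - q) \<le> s * (a \<bullet> (p - q)) + \<epsilon> * (\<bar>E (p - q)\<bar> + \<bar>F (p - q)\<bar>)"
    using app[of "p - q"] by linarith
  also have "\<dots> \<le> \<epsilon> * (\<bar>E (p - q)\<bar> + \<bar>F (p - q)\<bar>)"
    using a(2)[OF q(1)] s by (simp add: inner_diff_right mult_le_0_iff)
  also have "\<dots> \<le> \<epsilon> * (\<bar>B\<bar> + 1)"
    using B[OF q(1)] eps by (intro mult_left_mono) auto
  also have "\<dots> = t / 2" unfolding \<epsilon>_def by (simp add: field_simps)
  also have "\<dots> < t" using t by simp
  finally have less: "of_int k * m (p - q) < t" unfolding km .
  \<comment> \<open>Passing to the primitive vector is harmless: a value at least \<open>t\<close>,
    being positive, would not decrease on multiplication by \<open>k\<close>.\<close>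
  have "m (p - q) < t"
  proof (rule ccontr)
    assume "\<not> m (p - q) < t"
    then have "t \<le> m (p - q)" by simp
    also have "\<dots> \<le> of_int k * m (p - q)"
      using k t \<open>t \<le> m (p - q)\<close> by (simp add: mult_le_cancel_right1)
    finally show False using less by simp
  qed
  then show thesis using that[OF m] q(2) by (simp add: linear_diff[OF lin])
qed

section \<open>Finitely many half-planes suffice\<close>

lemma finite_polygon_Inter_shifted_half_planes:
  assumes \<Phi>: "compact \<Phi>" "convex \<Phi>" "\<Phi> \<noteq> {}" and t: "t > 0"
  shows "finite_polygon N (\<Inter>l \<in> Collect (primitive N). half_plane l (Inf (l ` \<Phi>) + t))"
proof -
  define P where "P = Collect (primitive N)"
  define H where "H l = half_plane l (Inf (l ` \<Phi>) + t)" for l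
  have linP: "linear l" if "l \<in> P" for l using that by (simp add: P_def primitiveD)
  have closedH: "closed (H l)" if "l \<in> P" for l
    unfolding H_def by (rule closed_half_plane[OF linP[OF that]])
  \<comment> \<open>These four slopes bound both coordinates from both sides, so their shifted
    half-planes cut out a compact parallelogram, possibly degenerate or empty.\<close>
  define B where "B = {functional 1 0, functional (-1) 0, functional 0 1, functional 0 (-1)}"
  have BP: "B \<subseteq> P" by (auto simp: B_def P_def intro!: primitive_functional)
  define C where "C = (\<Inter>l\<in>B. H l)"
  have "bounded C"
  proof -
    define b where "b = - (Inf (functional (-1) 0 ` \<Phi>) + t)"
    define a where "a = Inf (functional 1 0 ` \<Phi>) + t"
    define d where "d = - (Inf (functional 0 (-1) ` \<Phi>) + t)"
    define c where "c = Inf (functional 0 1 ` \<Phi>) + t"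
    have "norm v \<le> (\<bar>a\<bar> + \<bar>b\<bar>) * norm e + (\<bar>c\<bar> + \<bar>d\<bar>) * norm f" if "v \<in> C" for v
    proof -
      have "a \<le> E v" "E v \<le> b" "c \<le> F v" "F v \<le> d"
        using that by (auto simp: C_def B_def H_def half_plane_def a_def b_def c_def d_def functional_def)
      then have "\<bar>E v\<bar> \<le> \<bar>a\<bar> + \<bar>b\<bar>" "\<bar>F v\<bar> \<le> \<bar>c\<bar> + \<bar>d\<bar>" by linarith+
      then have "norm (E v *\<^sub>R e) + norm (F v *\<^sub>R f)
          \<le> (\<bar>a\<bar> + \<bar>b\<bar>) * norm e + (\<bar>c\<bar> + \<bar>d\<bar>) * norm f"
        by (auto intro!: add_mono mult_right_mono)
      moreover have "norm v \<le> norm (E v *\<^sub>R e) + norm (F v *\<^sub>R f)"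
        by (subst decompose[of v]) (rule norm_triangle_ineq)
      ultimately show ?thesis by linarith
    qed
    then show ?thesis unfolding bounded_iff by blast
  qed
  have "compact C"
    using \<open>bounded C\<close> closedH BP unfolding C_def compact_eq_bounded_closed by blast
  then have "compact (C - interior \<Phi>)" by (simp add: compact_diff)
  \<comment> \<open>The complements of the shifted half-planes form an open cover, from which a
    finite subcover \<open>S\<close> is extracted.\<close>
  moreover have "C - interior \<Phi> \<subseteq> (\<Union>l\<in>P. - H l)"
  proof
    fix p assume "p \<in> C - interior \<Phi>"
    then obtain l where "primitive N l" "l p < Inf (l ` \<Phi>) + t"
      using primitive_violated_outside_interior[OF \<Phi> t] by blast
    then show "p \<in> (\<Union>l\<in>P. - H l)" by (auto simp: P_def H_def half_plane_def)
  qed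
  ultimately obtain S where S: "S \<subseteq> P" "finite S" "C - interior \<Phi> \<subseteq> (\<Union>l\<in>S. - H l)"
    using compactE_image[of "C - interior \<Phi>" P "\<lambda>l. - H l"] closedH
    by (metis open_Compl)
  define K where "K = C \<inter> (\<Inter>l\<in>S. H l)"
  have "compact K"
    unfolding K_def using \<open>compact C\<close> S(1) closedH by (intro compact_Int_closed closed_INT) auto
  \<comment> \<open>If \<Phi> has empty interior, \<open>K\<close> is empty and the claims below
    about its points hold vacuously.\<close>
  moreover have "K \<subseteq> interior \<Phi>" using S(3) by (auto simp: K_def)
  ultimately obtain \<delta> where \<delta>: "\<delta> > 0" "(\<Union>p\<in>K. cball p \<delta>) \<subseteq> interior \<Phi>"
    using compact_subset_open_imp_cball_epsilon_subset[of K "interior \<Phi>"] by auto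
  have "e \<noteq> 0" "f \<noteq> 0" using dual_basis linear_0[OF linear_E] linear_0[OF linear_F] by auto
  \<comment> \<open>With this step length, moves by \<open>r\<close> along \<open>e\<close> or
    \<open>f\<close>, in either direction, have length at most \<delta> and so stay in
    \<Phi>.\<close>
  define r where "r = \<delta> / (norm e + norm f)"
  have r: "r > 0" using \<delta>(1) \<open>e \<noteq> 0\<close> unfolding r_def by (simp add: add_pos_nonneg)
  have "r * norm e \<le> \<delta>" "r * norm f \<le> \<delta>"
    using \<delta>(1) \<open>e \<noteq> 0\<close> unfolding r_def by (simp_all add: pos_divide_le_eq add_pos_nonneg)
  then have in\<Phi>: "p + c *\<^sub>R e \<in> \<Phi>" "p + c *\<^sub>R f \<in> \<Phi>" if "p \<in> K" "\<bar>c\<bar> = r" for p c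
    using \<delta>(2) that interior_subset[of \<Phi>] by (fastforce simp: dist_norm)+
  \<comment> \<open>Moving from \<open>p\<close> by \<open>r\<close> along \<open>e\<close> in the
    direction that decreases \<open>l\<close> lowers its value by \<open>r * \<bar>l e\<bar>\<close>
    without leaving \<Phi>; likewise for \<open>f\<close>.\<close>
  have gap: "Inf (l ` \<Phi>) + r * \<bar>l e\<bar> \<le> l p \<and> Inf (l ` \<Phi>) + r * \<bar>l f\<bar> \<le> l p"
    if "l \<in> P" "p \<in> K" for l p
  proof -
    note lin = linP[OF that(1)]
    have le: "Inf (l ` \<Phi>) \<le> l x" if "x \<in> \<Phi>" for x
      using linear_attains_Inf_on_compact[OF lin \<Phi>(1,3)] that by metis
    have "Inf (l ` \<Phi>) \<le> l p + c * l e" "Inf (l ` \<Phi>) \<le> l p + c * l f" if "\<bar>c\<bar> = r" for c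
      using le[OF in\<Phi>(1)[OF \<open>p \<in> K\<close> that]] le[OF in\<Phi>(2)[OF \<open>p \<in> K\<close> that]]
      by (simp_all add: linear_add[OF lin] linear_scale[OF lin])
    from this[of r] this[of "-r"] r show ?thesis by (auto simp: abs_if)
  qed
  \<comment> \<open>Since \<open>l e\<close> and \<open>l f\<close> are the integer coordinates of
    \<open>l\<close>, a coordinate of absolute value at least \<open>M\<close> makes the gap at
    least \<open>t\<close>. Only the finite box \<open>T\<close> remains.\<close>
  define M where "M = \<lceil>t / r\<rceil>"
  define T where "T = P \<inter> (\<lambda>(x, y). functional x y) ` ({-M..M} \<times> {-M..M})"
  define I where "I = B \<union> S \<union> T"
  have I: "finite I" "I \<subseteq> P" using S BP by (auto simp: I_def B_def T_def)
  have "p \<in> H l" if l: "l \<in> P" and p: "p \<in> (\<Inter>l\<in>I. H l)" for l p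
  proof (cases "l \<in> T")
    case True
    with p show ?thesis by (auto simp: I_def)
  next
    case False
    have "p \<in> K" using p by (auto simp: K_def C_def I_def)
    obtain x y where xy: "l = functional x y"
      using l by (auto simp: P_def primitive_def dual_lattice_eq_functionals)
    with False l have "\<not> (x \<in> {-M..M} \<and> y \<in> {-M..M})" unfolding T_def by blast
    then have "M \<le> \<bar>x\<bar> \<or> M \<le> \<bar>y\<bar>" by auto
    then have "t / r \<le> of_int \<bar>x\<bar> \<or> t / r \<le> of_int \<bar>y\<bar>"
      unfolding M_def ceiling_le_iff .
    then have "t \<le> r * \<bar>l e\<bar> \<or> t \<le> r * \<bar>l f\<bar>"
      using r by (simp add: xy functional_basis field_simps)
    then show ?thesis using gap[OF l \<open>p \<in> K\<close>] by (auto simp: H_def half_plane_def)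
  qed
  then have eq: "(\<Inter>l\<in>P. H l) = (\<Inter>l\<in>I. H l)" using I(2) by blast
  moreover have "bounded (\<Inter>l\<in>I. H l)"
    by (rule bounded_subset[OF \<open>bounded C\<close>]) (auto simp: C_def I_def)
  moreover have "rational_half_plane N (H l)" if "l \<in> I" for l
    using that I(2) by (auto simp: P_def H_def rational_half_plane_def)
  ultimately have "finite_polygon N (\<Inter>l\<in>P. H l)"
    unfolding finite_polygon_def using I(1) by (intro conjI exI[of _ "H ` I"]) auto
  then show ?thesis by (simp add: P_def H_def)
qed

end

section \<open>Existence of coordinates and conclusion\<close>

text \<open>The coordinate functionals extend the indicators of \<open>e\<close> and
  \<open>f\<close> linearly; in dimension two the independent pair spans.\<close>

lemma rank_two_lattice_imp_lattice_basis:
  fixes N :: "'a::euclidean_space set"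
  assumes dim: "DIM('a) = 2" and N: "rank_two_lattice N"
  obtains e f E F where "lattice_basis N e f E F"
proof -
  obtain e f where ef: "e \<noteq> f" "independent {e, f}"
    and Neq: "N = {of_int a *\<^sub>R e + of_int b *\<^sub>R f | a b :: int. True}"
    using N unfolding rank_two_lattice_def by blast
  have span: "span {e, f} = UNIV"
    using independent_explicit card_ge_dim_independent[of "{e,f}" UNIV] ef dim by auto
  obtain E :: "'a \<Rightarrow> real" where E: "linear E" "E e = 1" "E f = 0"
    using linear_independent_extend[OF ef(2), of "\<lambda>v. if v = e then 1 else 0"] ef(1) by auto
  obtain F :: "'a \<Rightarrow> real" where F: "linear F" "F e = 0" "F f = 1"
    using linear_independent_extend[OF ef(2), of "\<lambda>v. if v = f then 1 else 0"] ef(1) by auto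
  have "v = E v *\<^sub>R e + F v *\<^sub>R f" for v
  proof -
    have "v \<in> span {e, f}" using span by simp
    then obtain a b where "v = a *\<^sub>R e + b *\<^sub>R f"
      by (auto simp: span_breakdown_eq) (metis add.commute diff_add_cancel)
    then show ?thesis
      using E F by (simp add: linear_add linear_scale)
  qed
  then have "lattice_basis N e f E F" by (intro lattice_basis.intro Neq E F)
  then show thesis by (rule that)
qed

theorem corollary25:
  fixes N \<Phi> :: "'a::euclidean_space set" and t :: real
  assumes "DIM('a) = 2" and "rank_two_lattice N"
    and "admissible N \<Phi>" and "compact \<Phi>" and "t > 0"
  shows "finite_polygon N (tropical_propagation N \<Phi> t)"
proof -
  \<comment> \<open>Nonemptiness holds because some support half-plane meets the frontier of
    \<Phi>.\<close>
  have "convex \<Phi>" "\<Phi> \<noteq> {}"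
    using assms(3) by (auto simp: admissible_def support_half_planes_def)
  obtain e f E F where "lattice_basis N e f E F"
    using rank_two_lattice_imp_lattice_basis[OF assms(1,2)] .
  then interpret lattice_basis N e f E F .
  show ?thesis
    unfolding tropical_propagation_compact[OF assms(1,2,4) \<open>\<Phi> \<noteq> {}\<close>]
    using assms(4) \<open>convex \<Phi>\<close> \<open>\<Phi> \<noteq> {}\<close> assms(5)
    by (rule finite_polygon_Inter_shifted_half_planes)
qed

end
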